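(* Let $\mathcal{CS}$ be any constant specification. For every formula $A$ of the language of $\mathsf{LP}^{\mathsf{C}}_h$: $\vdash_{\mathcal{CS}} A$ if and only if $A$ is valid with respect to $\mathcal{CS}$, i.e. $\mathcal{M},w\Vdash A$ for every AF-model $\mathcal{M}$ meeting $\mathcal{CS}$ and every world $w$ of $\mathcal{M}$.
   Context: Fix a number $h\ge 1$ of agents. Throughout, $i$ ranges over $\{1,\dots,h\}$, $*$ over $\{1,\dots,h,\mathsf{C}\}$, and $\circledast$ over $\{1,\dots,h,\mathsf{E},\mathsf{C}\}$. For each $\circledast$ let $\mathrm{Cons}_\circledast$ (proof constants) and $\mathrm{Var}_\circledast$ (proof variables) be countably infinite sets, all pairwise disjoint. Evidence terms $\mathrm{Tm}_1,\dots,\mathrm{Tm}_h,\mathrm{Tm}_{\mathsf{E}},\mathrm{Tm}_{\mathsf{C}}$ are defined by simultaneous induction: $\mathrm{Cons}_\circledast\cup\mathrm{Var}_\circledast\subseteq\mathrm{Tm}_\circledast$; if $t\in\mathrm{Tm}_i$ then $!_i t\in\mathrm{Tm}_i$; if $t,s\in\mathrm{Tm}_*$ then $t+_*s,\ t\cdot_* s\in\mathrm{Tm}_*$; if $t_1\in\mathrm{Tm}_1,\dots,t_h\in\mathrm{Tm}_h$ then $\langle t_1,\dots,t_h\rangle\in\mathrm{Tm}_{\mathsf{E}}$; if $t\in\mathrm{Tm}_{\mathsf{E}}$ then $\pi_i t\in\mathrm{Tm}_i$; if $t\in\mathrm{Tm}_{\mathsf{C}}$ then $\mathsf{hd}(t),\mathsf{tl}(t)\in\mathrm{Tm}_{\mathsf{E}}$;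 if $t\in\mathrm{Tm}_{\mathsf{C}}$ and $s\in\mathrm{Tm}_{\mathsf{E}}$ then $\mathsf{ind}(t,s)\in\mathrm{Tm}_{\mathsf{C}}$. $\mathrm{Tm}$ is the union of all these sets. Formulae are built from a countable set $\mathrm{Prop}$ of propositional variables using $\neg,\wedge,\vee,\to$ and the rule: if $A$ is a formula and $t\in\mathrm{Tm}_\circledast$ then $t{:}_\circledast A$ is a formula (whenever $t{:}_\circledast A$ is written, $t\in\mathrm{Tm}_\circledast$ is assumed; indices on $!,+,\cdot$ are omitted when clear). Axioms of $\mathsf{LP}^{\mathsf{C}}_h$ (all instances): (1) propositional tautologies; (2) $t{:}_*(A\to B)\to(s{:}_*A\to (t\cdot s){:}_*B)$; (3) $t{:}_*A\to(t+s){:}_*A$ and $s{:}_*A\to(t+s){:}_*A$; (4) $t{:}_iA\to A$; (5) $t{:}_iA\to (!t){:}_i\, t{:}_iA$; (6) $t_1{:}_1A\wedge\dots\wedge t_h{:}_hA\to\langle t_1,\dots,t_h\rangle{:}_{\mathsf{E}}A$; (7) $t{:}_{\mathsf{E}}A\to (\pi_it){:}_iA$; (8) $t{:}_{\mathsf{C}}A\to\mathsf{hd}(t){:}_{\mathsf{E}}A$ and $t{:}_{\mathsf{C}}A\to\mathsf{tl}(t){:}_{\mathsf{E}}\,t{:}_{\mathsf{C}}A$; (9) $A\wedge t{:}_{\mathsf{C}}(A\to s{:}_{\mathsf{E}}A)\to\mathsf{ind}(t,s){:}_{\mathsf{C}}A$. A constant specification $\mathcal{CS}$ is any set of formulae $c{:}_\circledast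 A$ with $c\in\mathrm{Cons}_\circledast$ (for any $\circledast$) and $A$ an axiom. $\mathsf{LP}^{\mathsf{C}}_h(\mathcal{CS})$ is the Hilbert system with these axioms, modus ponens, and axiom necessitation (derive $c{:}_\circledast A$ from no premises whenever $c{:}_\circledast A\in\mathcal{CS}$); $\Delta\vdash_{\mathcal{CS}}A$ means $A$ is derivable from the set of assumptions $\Delta$ in it. AF-models: an AF-model meeting $\mathcal{CS}$ is $\mathcal{M}=(W,R,\mathcal{E},\nu)$ with $W\neq\emptyset$, reflexive transitive relations $R_1,\dots,R_h$ on $W$, $\nu:\mathrm{Prop}\to\mathcal{P}(W)$, $R_{\mathsf{E}}:=R_1\cup\dots\cup R_h$, $R_{\mathsf{C}}:=\bigcup_{n\ge1}(R_{\mathsf{E}})^n$, and an evidence function $\mathcal{E}:W\times\mathrm{Tm}\to\mathcal{P}(\text{formulae})$, writing $\mathcal{E}_\circledast$ for its restriction to $W\times\mathrm{Tm}_\circledast$, such that for all $w,v\in W$: (monotonicity) $\mathcal{E}_*(w,t)\subseteq\mathcal{E}_*(v,t)$ whenever $(w,v)\in R_*$; (constant specification) $c{:}_\circledast A\in\mathcal{CS}$ implies $A\in\mathcal{E}_\circledast(w,c)$; (application) $A\to B\in\mathcal{E}_*(w,t)$ and $A\in\mathcal{E}_*(w,s)$ imply $B\in\mathcal{E}_*(w,t\cdot s)$; (sum) $\mathcal{E}_*(w,s)\cup\mathcal{E}_*(w,t)\subseteq\mathcal{E}_*(w,s+t)$; (inspection) $A\in\mathcal{E}_i(w,t)$ implies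 $t{:}_iA\in\mathcal{E}_i(w,!t)$; (tupling) $A\in\mathcal{E}_i(w,t_i)$ for all $i$ implies $A\in\mathcal{E}_{\mathsf{E}}(w,\langle t_1,\dots,t_h\rangle)$; (projection) $A\in\mathcal{E}_{\mathsf{E}}(w,t)$ implies $A\in\mathcal{E}_i(w,\pi_it)$; (co-closure) $A\in\mathcal{E}_{\mathsf{C}}(w,t)$ implies $A\in\mathcal{E}_{\mathsf{E}}(w,\mathsf{hd}(t))$ and $t{:}_{\mathsf{C}}A\in\mathcal{E}_{\mathsf{E}}(w,\mathsf{tl}(t))$; (induction) $A\in\mathcal{E}_{\mathsf{E}}(w,s)$ and $A\to s{:}_{\mathsf{E}}A\in\mathcal{E}_{\mathsf{C}}(w,t)$ imply $A\in\mathcal{E}_{\mathsf{C}}(w,\mathsf{ind}(t,s))$. Satisfaction: $\mathcal{M},w\Vdash P$ iff $w\in\nu(P)$; classical for connectives; $\mathcal{M},w\Vdash t{:}_\circledast A$ iff $A\in\mathcal{E}_\circledast(w,t)$ and $\mathcal{M},v\Vdash A$ for all $v$ with $(w,v)\in R_\circledast$. *)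

theory Defs
  imports "HOL-Library.Countable"
begin

text \<open>Agents are the natural numbers \<open>1, \<dots>, h\<close>. The number \<open>h\<close> is a parameter of the notions
  below, so the raw syntax is cut down to the language for \<open>h\<close> agents by \<open>is_tm\<close> and \<open>Fm\<close>.\<close>

datatype sort = Agent nat | Everyone | Common

definition star_sorts :: "nat \<Rightarrow> sort set" where
  "star_sorts h = Agent ` {1..h} \<union> {Common}"

definition all_sorts :: "nat \<Rightarrow> sort set" where
  "all_sorts h = Agent ` {1..h} \<union> {Everyone, Common}"

datatype tm =
    Const sort nat
  | Var sort nat
  | Bang nat tm
  | Plus sort tm tm
  | Times sort tm tm
  | Tup "tm list"
  | Proj nat tm
  | Hd tm
  | Tl tm
  | Ind tm tm

text \<open>\<open>is_tm h s t\<close> means \<open>t \<in> Tm\<^sub>s\<close>. List positions start at 0 and agents at 1, so the component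
  of \<open>Tup ts\<close> for agent \<open>i\<close> is \<open>ts ! (i - 1)\<close>.\<close>

inductive is_tm :: "nat \<Rightarrow> sort \<Rightarrow> tm \<Rightarrow> bool" for h :: nat where
  "s \<in> all_sorts h \<Longrightarrow> is_tm h s (Const s n)"
| "s \<in> all_sorts h \<Longrightarrow> is_tm h s (Var s n)"
| "i \<in> {1..h} \<Longrightarrow> is_tm h (Agent i) t \<Longrightarrow> is_tm h (Agent i) (Bang i t)"
| "s \<in> star_sorts h \<Longrightarrow> is_tm h s t \<Longrightarrow> is_tm h s u \<Longrightarrow> is_tm h s (Plus s t u)"
| "s \<in> star_sorts h \<Longrightarrow> is_tm h s t \<Longrightarrow> is_tm h s u \<Longrightarrow> is_tm h s (Times s t u)"
| "length ts = h \<Longrightarrow> \<forall>i\<in>{1..h}. is_tm h (Agent i) (ts ! (i - 1)) \<Longrightarrow> is_tm h Everyone (Tup ts)"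
| "i \<in> {1..h} \<Longrightarrow> is_tm h Everyone t \<Longrightarrow> is_tm h (Agent i) (Proj i t)"
| "is_tm h Common t \<Longrightarrow> is_tm h Everyone (Hd t)"
| "is_tm h Common t \<Longrightarrow> is_tm h Everyone (Tl t)"
| "is_tm h Common t \<Longrightarrow> is_tm h Everyone u \<Longrightarrow> is_tm h Common (Ind t u)"

definition Tm :: "nat \<Rightarrow> tm set" where
  "Tm h = (\<Union>s\<in>all_sorts h. {t. is_tm h s t})"

text \<open>\<open>Just s t A\<close> is \<open>t :\<^sub>s A\<close>.\<close>

datatype 'p fm =
    Prop 'p
  | Neg "'p fm"
  | And "'p fm" "'p fm"
  | Or "'p fm" "'p fm"
  | Imp "'p fm" "'p fm"
  | Just sort tm "'p fm"

inductive_set Fm :: "nat \<Rightarrow> 'p fm set" for h :: nat where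
  "Prop P \<in> Fm h"
| "A \<in> Fm h \<Longrightarrow> Neg A \<in> Fm h"
| "A \<in> Fm h \<Longrightarrow> B \<in> Fm h \<Longrightarrow> And A B \<in> Fm h"
| "A \<in> Fm h \<Longrightarrow> B \<in> Fm h \<Longrightarrow> Or A B \<in> Fm h"
| "A \<in> Fm h \<Longrightarrow> B \<in> Fm h \<Longrightarrow> Imp A B \<in> Fm h"
| "s \<in> all_sorts h \<Longrightarrow> is_tm h s t \<Longrightarrow> A \<in> Fm h \<Longrightarrow> Just s t A \<in> Fm h"

text \<open>Tautologies treat \<open>t :\<^sub>s A\<close> as atomic, i.e.\ they are the substitution instances of
  classical tautologies.\<close>

fun peval :: "('p fm \<Rightarrow> bool) \<Rightarrow> 'p fm \<Rightarrow> bool" where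
  "peval v (Prop P) = v (Prop P)"
| "peval v (Neg A) = (\<not> peval v A)"
| "peval v (And A B) = (peval v A \<and> peval v B)"
| "peval v (Or A B) = (peval v A \<or> peval v B)"
| "peval v (Imp A B) = (peval v A \<longrightarrow> peval v B)"
| "peval v (Just s t A) = v (Just s t A)"

definition tautology :: "'p fm \<Rightarrow> bool" where
  "tautology A \<longleftrightarrow> (\<forall>v. peval v A)"

text \<open>Conjunction of a nonempty list, associating to the left.\<close>

definition conj_list :: "'p fm list \<Rightarrow> 'p fm" where
  "conj_list As = foldl And (hd As) (tl As)"

text \<open>The side conditions on terms and sorts in each scheme are left to the intersection with
  \<open>Fm h\<close> in \<open>Axioms\<close>; for example \<open>Just s (Times s t u) B \<in> Fm h\<close> forces \<open>s \<in> star_sorts h\<close>.\<close>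

inductive axiom_scheme :: "nat \<Rightarrow> 'p fm \<Rightarrow> bool" for h :: nat where
  taut: "tautology A \<Longrightarrow> axiom_scheme h A"
| app: "axiom_scheme h (Imp (Just s t (Imp A B)) (Imp (Just s u A) (Just s (Times s t u) B)))"
| sum_left: "axiom_scheme h (Imp (Just s t A) (Just s (Plus s t u) A))"
| sum_right: "axiom_scheme h (Imp (Just s u A) (Just s (Plus s t u) A))"
| reflection: "axiom_scheme h (Imp (Just (Agent i) t A) A)"
| inspection: "axiom_scheme h
    (Imp (Just (Agent i) t A) (Just (Agent i) (Bang i t) (Just (Agent i) t A)))"
| tupling: "axiom_scheme h
    (Imp (conj_list (map (\<lambda>i. Just (Agent i) (ts ! (i - 1)) A) [1..<Suc h]))
         (Just Everyone (Tup ts) A))"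
| projection: "axiom_scheme h (Imp (Just Everyone t A) (Just (Agent i) (Proj i t) A))"
| co_closure_hd: "axiom_scheme h (Imp (Just Common t A) (Just Everyone (Hd t) A))"
| co_closure_tl: "axiom_scheme h
    (Imp (Just Common t A) (Just Everyone (Tl t) (Just Common t A)))"
| induction: "axiom_scheme h
    (Imp (And A (Just Common t (Imp A (Just Everyone u A)))) (Just Common (Ind t u) A))"

definition Axioms :: "nat \<Rightarrow> 'p fm set" where
  "Axioms h = {A \<in> Fm h. axiom_scheme h A}"

definition constant_specification :: "nat \<Rightarrow> 'p fm set \<Rightarrow> bool" where
  "constant_specification h CS \<longleftrightarrow>
     CS \<subseteq> {Just s (Const s n) A | s n A. s \<in> all_sorts h \<and> A \<in> Axioms h}"

inductive derives :: "nat \<Rightarrow> 'p fm set \<Rightarrow> 'p fm set \<Rightarrow> 'p fm \<Rightarrow> bool"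
  for h :: nat and CS :: "'p fm set" and \<Delta> :: "'p fm set" where
  assumption: "A \<in> \<Delta> \<Longrightarrow> derives h CS \<Delta> A"
| "axiom": "A \<in> Axioms h \<Longrightarrow> derives h CS \<Delta> A"
| modus_ponens: "derives h CS \<Delta> (Imp A B) \<Longrightarrow> derives h CS \<Delta> A \<Longrightarrow> derives h CS \<Delta> B"
| axiom_necessitation: "Just s (Const s n) A \<in> CS \<Longrightarrow> derives h CS \<Delta> (Just s (Const s n) A)"

record ('w, 'p) kripke =
  worlds :: "'w set"
  acc :: "nat \<Rightarrow> ('w \<times> 'w) set"
  evidence :: "'w \<Rightarrow> tm \<Rightarrow> 'p fm set"
  valuation :: "'p \<Rightarrow> 'w set"

definition acc_E :: "nat \<Rightarrow> ('w, 'p) kripke \<Rightarrow> ('w \<times> 'w) set" where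
  "acc_E h M = (\<Union>i\<in>{1..h}. acc M i)"

definition acc_C :: "nat \<Rightarrow> ('w, 'p) kripke \<Rightarrow> ('w \<times> 'w) set" where
  "acc_C h M = (\<Union>n\<in>{1..}. acc_E h M ^^ n)"

fun acc_sort :: "nat \<Rightarrow> ('w, 'p) kripke \<Rightarrow> sort \<Rightarrow> ('w \<times> 'w) set" where
  "acc_sort h M (Agent i) = acc M i"
| "acc_sort h M Everyone = acc_E h M"
| "acc_sort h M Common = acc_C h M"

text \<open>The values of \<open>acc M\<close> outside \<open>{1..h}\<close> and of \<open>evidence M\<close> outside \<open>worlds M \<times> Tm h\<close> are
  junk: they are unconstrained, and satisfaction of formulae in \<open>Fm h\<close> at worlds of \<open>M\<close> does not
  depend on them.\<close>

locale af_model =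
  fixes h :: nat and CS :: "'p fm set" and M :: "('w, 'p) kripke"
  assumes worlds_nonempty: "worlds M \<noteq> {}"
    and acc_on: "\<And>i. i \<in> {1..h} \<Longrightarrow> acc M i \<subseteq> worlds M \<times> worlds M"
    and acc_refl: "\<And>i. i \<in> {1..h} \<Longrightarrow> refl_on (worlds M) (acc M i)"
    and acc_trans: "\<And>i. i \<in> {1..h} \<Longrightarrow> trans (acc M i)"
    and valuation_on: "\<And>P. valuation M P \<subseteq> worlds M"
    and evidence_on: "\<And>w t. \<lbrakk>w \<in> worlds M; t \<in> Tm h\<rbrakk> \<Longrightarrow> evidence M w t \<subseteq> Fm h"
    and monotonicity:
      "\<And>s w v t. \<lbrakk>s \<in> star_sorts h; w \<in> worlds M; v \<in> worlds M; is_tm h s t;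
        (w, v) \<in> acc_sort h M s\<rbrakk> \<Longrightarrow> evidence M w t \<subseteq> evidence M v t"
    and evidence_const:
      "\<And>w s n A. \<lbrakk>w \<in> worlds M; Just s (Const s n) A \<in> CS\<rbrakk> \<Longrightarrow> A \<in> evidence M w (Const s n)"
    and evidence_app:
      "\<And>w s t u A B. \<lbrakk>w \<in> worlds M; s \<in> star_sorts h; is_tm h s t; is_tm h s u;
        Imp A B \<in> evidence M w t; A \<in> evidence M w u\<rbrakk> \<Longrightarrow> B \<in> evidence M w (Times s t u)"
    and evidence_sum:
      "\<And>w s t u. \<lbrakk>w \<in> worlds M; s \<in> star_sorts h; is_tm h s t; is_tm h s u\<rbrakk>
        \<Longrightarrow> evidence M w t \<union> evidence M w u \<subseteq> evidence M w (Plus s t u)"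
    and evidence_inspection:
      "\<And>w i t A. \<lbrakk>w \<in> worlds M; i \<in> {1..h}; is_tm h (Agent i) t; A \<in> evidence M w t\<rbrakk>
        \<Longrightarrow> Just (Agent i) t A \<in> evidence M w (Bang i t)"
    and evidence_tupling:
      "\<And>w ts A. \<lbrakk>w \<in> worlds M; length ts = h; \<forall>i\<in>{1..h}. is_tm h (Agent i) (ts ! (i - 1));
        \<forall>i\<in>{1..h}. A \<in> evidence M w (ts ! (i - 1))\<rbrakk> \<Longrightarrow> A \<in> evidence M w (Tup ts)"
    and evidence_projection:
      "\<And>w i t A. \<lbrakk>w \<in> worlds M; i \<in> {1..h}; is_tm h Everyone t; A \<in> evidence M w t\<rbrakk>
        \<Longrightarrow> A \<in> evidence M w (Proj i t)"
    and evidence_co_closure: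
      "\<And>w t A. \<lbrakk>w \<in> worlds M; is_tm h Common t; A \<in> evidence M w t\<rbrakk>
        \<Longrightarrow> A \<in> evidence M w (Hd t) \<and> Just Common t A \<in> evidence M w (Tl t)"
    and evidence_induction:
      "\<And>w t u A. \<lbrakk>w \<in> worlds M; is_tm h Common t; is_tm h Everyone u; A \<in> evidence M w u;
        Imp A (Just Everyone u A) \<in> evidence M w t\<rbrakk> \<Longrightarrow> A \<in> evidence M w (Ind t u)"

fun sat :: "nat \<Rightarrow> ('w, 'p) kripke \<Rightarrow> 'w \<Rightarrow> 'p fm \<Rightarrow> bool" where
  "sat h M w (Prop P) \<longleftrightarrow> w \<in> valuation M P"
| "sat h M w (Neg A) \<longleftrightarrow> \<not> sat h M w A"
| "sat h M w (And A B) \<longleftrightarrow> sat h M w A \<and> sat h M w B"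
| "sat h M w (Or A B) \<longleftrightarrow> sat h M w A \<or> sat h M w B"
| "sat h M w (Imp A B) \<longleftrightarrow> (sat h M w A \<longrightarrow> sat h M w B)"
| "sat h M w (Just s t A) \<longleftrightarrow>
     A \<in> evidence M w t \<and> (\<forall>v. (w, v) \<in> acc_sort h M s \<longrightarrow> sat h M v A)"

text \<open>HOL cannot quantify over the type of worlds inside a formula, so validity has it as a
  parameter; a model's set of worlds is any nonempty subset of that type.\<close>

definition valid :: "'w itself \<Rightarrow> nat \<Rightarrow> 'p fm set \<Rightarrow> 'p fm \<Rightarrow> bool" where
  "valid TYPE('w) h CS A \<longleftrightarrow>
     (\<forall>M :: ('w, 'p) kripke. af_model h CS M \<longrightarrow> (\<forall>w\<in>worlds M. sat h M w A))"

end

theory Submission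
  imports Defs
begin

text \<open>Soundness is an induction on derivations. For completeness a single world is enough, which
  is why the type of worlds may be arbitrary: since every \<open>t :\<^sub>s A\<close> provably implies \<open>A\<close> (for
  \<open>Everyone\<close> and \<open>Common\<close> through a projection and a head, using \<open>h \<ge> 1\<close>), a set \<open>\<Gamma>\<close> that is
  maximal among the sets not deriving a given formula is the theory of the one-world reflexive
  model in which \<open>A\<close> is evidenced by \<open>t\<close> iff \<open>t :\<^sub>s A \<in> \<Gamma>\<close>.\<close>

section \<open>Syntax\<close>

lemma is_tm_simps [simp]:
  "is_tm h s (Const s' n) \<longleftrightarrow> s = s' \<and> s \<in> all_sorts h"
  "is_tm h s (Var s' n) \<longleftrightarrow> s = s' \<and> s \<in> all_sorts h"
  "is_tm h s (Bang i t) \<longleftrightarrow> s = Agent i \<and> i \<in> {1..h} \<and> is_tm h (Agent i) t"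
  "is_tm h s (Plus s' t u) \<longleftrightarrow> s = s' \<and> s \<in> star_sorts h \<and> is_tm h s t \<and> is_tm h s u"
  "is_tm h s (Times s' t u) \<longleftrightarrow> s = s' \<and> s \<in> star_sorts h \<and> is_tm h s t \<and> is_tm h s u"
  "is_tm h s (Tup ts) \<longleftrightarrow>
     s = Everyone \<and> length ts = h \<and> (\<forall>i\<in>{1..h}. is_tm h (Agent i) (ts ! (i - 1)))"
  "is_tm h s (Proj i t) \<longleftrightarrow> s = Agent i \<and> i \<in> {1..h} \<and> is_tm h Everyone t"
  "is_tm h s (Hd t) \<longleftrightarrow> s = Everyone \<and> is_tm h Common t"
  "is_tm h s (Tl t) \<longleftrightarrow> s = Everyone \<and> is_tm h Common t"
  "is_tm h s (Ind t u) \<longleftrightarrow> s = Common \<and> is_tm h Common t \<and> is_tm h Everyone u"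
  by (auto elim: is_tm.cases intro: is_tm.intros)

text \<open>The top constructor of a term, together with the sort or agent it carries, fixes the
  sort. This is what lets an evidence function take a bare term.\<close>

lemma is_tm_unique_sort: "is_tm h s t \<Longrightarrow> is_tm h s' t \<Longrightarrow> s = s'"
  by (cases t) auto

lemma Fm_simps [simp]:
  "Prop P \<in> Fm h"
  "Neg A \<in> Fm h \<longleftrightarrow> A \<in> Fm h"
  "And A B \<in> Fm h \<longleftrightarrow> A \<in> Fm h \<and> B \<in> Fm h"
  "Or A B \<in> Fm h \<longleftrightarrow> A \<in> Fm h \<and> B \<in> Fm h"
  "Imp A B \<in> Fm h \<longleftrightarrow> A \<in> Fm h \<and> B \<in> Fm h"
  "Just s t A \<in> Fm h \<longleftrightarrow> s \<in> all_sorts h \<and> is_tm h s t \<and> A \<in> Fm h"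
  by (auto elim: Fm.cases intro: Fm.intros)

lemma sorts_simps [simp]:
  "Agent i \<in> all_sorts h \<longleftrightarrow> i \<in> {1..h}"
  "Everyone \<in> all_sorts h"
  "Common \<in> all_sorts h"
  "Agent i \<in> star_sorts h \<longleftrightarrow> i \<in> {1..h}"
  "Common \<in> star_sorts h"
  by (auto simp: all_sorts_def star_sorts_def)

lemma foldl_And_Fm: "foldl And A As \<in> Fm h \<longleftrightarrow> A \<in> Fm h \<and> set As \<subseteq> Fm h"
  by (induction As arbitrary: A) auto

lemma conj_list_Fm: "As \<noteq> [] \<Longrightarrow> conj_list As \<in> Fm h \<longleftrightarrow> set As \<subseteq> Fm h"
  by (cases As) (auto simp: conj_list_def foldl_And_Fm)

lemma peval_foldl_And: "peval v (foldl And A As) \<longleftrightarrow> peval v A \<and> (\<forall>B\<in>set As. peval v B)"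
  by (induction As arbitrary: A) auto

lemma peval_conj_list: "As \<noteq> [] \<Longrightarrow> peval v (conj_list As) \<longleftrightarrow> (\<forall>A\<in>set As. peval v A)"
  by (cases As) (auto simp: conj_list_def peval_foldl_And)

lemma constant_specification_subset_Fm: "constant_specification h CS \<Longrightarrow> CS \<subseteq> Fm h"
  by (auto simp: constant_specification_def Axioms_def)

section \<open>Soundness\<close>

text \<open>The clauses for the connectives agree, so satisfaction at a fixed world is itself a
  propositional valuation. Tautologies and list conjunctions can then be evaluated without looking
  inside justified formulae.\<close>

lemma peval_sat: "peval (sat h M w) A \<longleftrightarrow> sat h M w A"
  by (induction A) auto

lemma acc_E_subset_acc_C: "acc_E h M \<subseteq> acc_C h M"
proof -
  have "acc_E h M ^^ 1 \<subseteq> acc_C h M"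
    unfolding acc_C_def by (rule UN_upper) simp
  then show ?thesis by simp
qed

text \<open>The closure form gives transitivity of common reachability and induction along paths of
  \<open>acc_E\<close> steps.\<close>

lemma acc_C_eq_trancl: "acc_C h M = (acc_E h M)\<^sup>+"
  by (rule set_eqI) (simp add: acc_C_def trancl_power split_paired_all Bex_def Suc_le_eq)

context af_model
begin

text \<open>\<open>sat\<close> quantifies over all related points of the type; this puts them among
  the worlds, where monotonicity and the truth of the axioms are available.\<close>

lemma acc_sort_subset:
  assumes "s \<in> all_sorts h"
  shows "acc_sort h M s \<subseteq> worlds M \<times> worlds M"
proof -
  have E: "acc_E h M \<subseteq> worlds M \<times> worlds M"
    unfolding acc_E_def using acc_on by (intro UN_least)
  then have "acc_C h M \<subseteq> worlds M \<times> worlds M"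
    unfolding acc_C_eq_trancl by (rule trancl_subset_Sigma)
  with E acc_on assms show ?thesis by (cases s) simp_all
qed

lemma acc_E_refl: "h \<ge> 1 \<Longrightarrow> w \<in> worlds M \<Longrightarrow> (w, w) \<in> acc_E h M"
  using acc_refl[of 1] by (auto simp: acc_E_def refl_on_def)

text \<open>Most schemes split into an evidence half, settled by the matching condition of
  \<open>af_model\<close>, and a half about truth at accessible worlds.\<close>

lemma sat_axiom:
  assumes h: "h \<ge> 1" and ax: "A \<in> Axioms h" and w: "w \<in> worlds M"
  shows "sat h M w A"
proof -
  from ax have "axiom_scheme h A" and Fm: "A \<in> Fm h" by (auto simp: Axioms_def)
  then show ?thesis
  proof cases
    case taut
    then show ?thesis using peval_sat[of h M w A] by (simp add: tautology_def)
  next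
    case (app s t B C u)
    with Fm w show ?thesis by (auto intro: evidence_app)
  next
    case (sum_left s t B u)
    with Fm evidence_sum[OF w, of s t u] show ?thesis by auto
  next
    case (sum_right s u B t)
    with Fm evidence_sum[OF w, of s t u] show ?thesis by auto
  next
    case (reflection i t B)
    with Fm w acc_refl[of i] show ?thesis by (auto simp: refl_on_def)
  next
    case (inspection i t B)
    then have i: "i \<in> {1..h}" and t: "is_tm h (Agent i) t" using Fm by auto
    \<comment> \<open>Monotonicity carries the evidence from \<open>w\<close> to \<open>v\<close>;
      transitivity carries the truth of \<open>B\<close> to every successor of
      \<open>v\<close>.\<close>
    have "sat h M v (Just (Agent i) t B)"
      if B: "sat h M w (Just (Agent i) t B)" and v: "(w, v) \<in> acc M i" for v
    proof -
      have "v \<in> worlds M" using acc_on[OF i] v by auto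
      then have "evidence M w t \<subseteq> evidence M v t"
        using monotonicity[of "Agent i" w v t] i t w v by auto
      moreover have "(w, u) \<in> acc M i" if "(v, u) \<in> acc M i" for u
        using acc_trans[OF i] v that by (blast dest: transD)
      ultimately show ?thesis using B by auto
    qed
    moreover have "Just (Agent i) t B \<in> evidence M w (Bang i t)" if "sat h M w (Just (Agent i) t B)"
      using evidence_inspection w i t that by simp
    ultimately have "sat h M w (Just (Agent i) (Bang i t) (Just (Agent i) t B))"
      if "sat h M w (Just (Agent i) t B)"
      \<comment> \<open>Only the outer justification is unfolded, so the inner one stays intact and
        matches the fact about \<open>v\<close>.\<close>
      unfolding sat.simps(6)[of h M w "Agent i" "Bang i t"] acc_sort.simps using that by blast
    then show ?thesis unfolding inspection sat.simps(5) by blast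
  next
    case (tupling ts B)
    have ts: "length ts = h" "\<forall>i\<in>{1..h}. is_tm h (Agent i) (ts ! (i - 1))"
      using Fm tupling by auto
    \<comment> \<open>Passing through \<open>peval\<close> turns the nested conjunction into a
      quantifier over agents; the list is nonempty because \<open>h \<ge> 1\<close>.\<close>
    have "sat h M w (conj_list (map (\<lambda>i. Just (Agent i) (ts ! (i - 1)) B) [1..<Suc h])) \<longleftrightarrow>
        (\<forall>i\<in>{1..h}. sat h M w (Just (Agent i) (ts ! (i - 1)) B))"
      using h by (subst peval_sat[symmetric], subst peval_conj_list)
        (auto simp: peval_sat atLeastLessThanSuc_atLeastAtMost simp del: upt_Suc)
    moreover have "B \<in> evidence M w (Tup ts)" if "\<forall>i\<in>{1..h}. B \<in> evidence M w (ts ! (i - 1))"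
      using evidence_tupling w ts that by blast
    ultimately show ?thesis using tupling by (auto simp: acc_E_def simp del: upt_Suc)
  next
    case (projection t B i)
    with Fm w show ?thesis by (fastforce intro: evidence_projection simp: acc_E_def)
  next
    case (co_closure_hd t B)
    with Fm evidence_co_closure[OF w] acc_E_subset_acc_C show ?thesis by fastforce
  next
    case (co_closure_tl t B)
    then have t: "is_tm h Common t" using Fm by auto
    have "sat h M v (Just Common t B)"
      if B: "sat h M w (Just Common t B)" and v: "(w, v) \<in> acc_E h M" for v
    proof -
      \<comment> \<open>A single everyone-step is a path of length one, so it can be prepended to
        any path leaving \<open>v\<close>.\<close>
      have wv: "(w, v) \<in> acc_C h M" using v acc_E_subset_acc_C by blast
      moreover have "v \<in> worlds M" using acc_sort_subset[of Everyone] v by auto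
      ultimately have "evidence M w t \<subseteq> evidence M v t"
        using monotonicity[of Common w v t] t w by auto
      moreover have "(w, u) \<in> acc_C h M" if "(v, u) \<in> acc_C h M" for u
        using wv that by (auto simp: acc_C_eq_trancl)
      ultimately show ?thesis using B by auto
    qed
    moreover have "Just Common t B \<in> evidence M w (Tl t)" if "sat h M w (Just Common t B)"
      using evidence_co_closure[OF w t] that by simp
    ultimately have "sat h M w (Just Everyone (Tl t) (Just Common t B))"
      if "sat h M w (Just Common t B)"
      unfolding sat.simps(6)[of h M w Everyone "Tl t"] acc_sort.simps using that by blast
    then show ?thesis unfolding co_closure_tl sat.simps(5) by blast
  next
    case (induction B t u)
    then have t: "is_tm h Common t" and u: "is_tm h Everyone u" using Fm by auto
    have "sat h M w (Just Common (Ind t u) B)"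
      if B: "sat h M w B" and ev: "Imp B (Just Everyone u B) \<in> evidence M w t"
        and all: "\<forall>v. (w, v) \<in> acc_C h M \<longrightarrow> sat h M v (Imp B (Just Everyone u B))"
    proof -
      \<comment> \<open>The implication is only known at worlds reachable from \<open>w\<close>.
        Reflexivity makes \<open>w\<close> one of them, which yields both the evidence for
        \<open>B\<close> by \<open>u\<close> and the first step of every path.\<close>
      have ww: "(w, w) \<in> acc_E h M" using acc_E_refl h w .
      then have step: "sat h M w (Just Everyone u B)"
        using all B acc_E_subset_acc_C by fastforce
      then have "B \<in> evidence M w (Ind t u)"
        using evidence_induction w t u ev by auto
      \<comment> \<open>Truth of \<open>B\<close> spreads along a path, since the implication holds
        at every world reached.\<close>
      moreover have "sat h M v B" if "(w, v) \<in> acc_C h M" for v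
        using that unfolding acc_C_eq_trancl
      proof (induction rule: trancl_induct)
        case (base v)
        then show ?case using step by auto
      next
        case (step v v')
        then show ?case using all unfolding acc_C_eq_trancl by auto
      qed
      ultimately show ?thesis by simp
    qed
    then show ?thesis
      unfolding induction sat.simps(3,5) sat.simps(6)[of h M w Common t] acc_sort.simps by blast
  qed
qed

lemma sat_derives:
  assumes h: "h \<ge> 1" and CS: "constant_specification h CS"
    and "derives h CS {} A" and "w \<in> worlds M"
  shows "sat h M w A"
  using assms(3,4)
proof (induction arbitrary: w rule: derives.induct)
  case (assumption A)
  then show ?case by simp
next
  case ("axiom" A)
  then show ?case using sat_axiom h by blast
next
  case (modus_ponens A B)
  then show ?case by auto
next
  case (axiom_necessitation s n A)
  \<comment> \<open>A constant justifies an axiom, and axioms are already true at every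
    world.\<close>
  then have "s \<in> all_sorts h" "A \<in> Axioms h"
    using CS by (auto simp: constant_specification_def)
  then have "sat h M v A" if "(w, v) \<in> acc_sort h M s" for v
    using sat_axiom[OF h] acc_sort_subset that by blast
  then show ?case using axiom_necessitation evidence_const by auto
qed

end

section \<open>Derivations\<close>

lemma derives_mono: "derives h CS \<Delta> A \<Longrightarrow> \<Delta> \<subseteq> \<Delta>' \<Longrightarrow> derives h CS \<Delta>' A"
  by (induction rule: derives.induct) (auto intro: derives.intros)

lemma derives_taut: "A \<in> Fm h \<Longrightarrow> tautology A \<Longrightarrow> derives h CS \<Delta> A"
  by (rule derives.axiom) (simp add: Axioms_def axiom_scheme.taut)

lemma derives_taut_mp1:
  "derives h CS \<Delta> A \<Longrightarrow> Imp A B \<in> Fm h \<Longrightarrow> tautology (Imp A B) \<Longrightarrow> derives h CS \<Delta> B"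
  using derives.modus_ponens derives_taut by blast

lemma derives_taut_mp2:
  "derives h CS \<Delta> A \<Longrightarrow> derives h CS \<Delta> B \<Longrightarrow> Imp A (Imp B C) \<in> Fm h \<Longrightarrow>
    tautology (Imp A (Imp B C)) \<Longrightarrow> derives h CS \<Delta> C"
  using derives.modus_ponens derives_taut by blast

lemma derives_Fm:
  assumes "CS \<subseteq> Fm h" "\<Delta> \<subseteq> Fm h" "derives h CS \<Delta> A"
  shows "A \<in> Fm h"
  using assms(3,1,2) by (induction rule: derives.induct) (auto simp: Axioms_def)

text \<open>Modus ponens is the only rule with premises. Axiom necessitation depends on no
  assumptions, so prefixing \<open>A\<close> by weakening covers it.\<close>

lemma deduction:
  assumes CS: "CS \<subseteq> Fm h" and \<Delta>: "\<Delta> \<subseteq> Fm h" and A: "A \<in> Fm h"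
    and "derives h CS (insert A \<Delta>) B"
  shows "derives h CS \<Delta> (Imp A B)"
proof -
  have weaken: "derives h CS \<Delta> (Imp A B)" if "derives h CS \<Delta> B" for B
    using derives_taut_mp1[OF that, of "Imp A B"] derives_Fm[OF CS \<Delta> that] A
    by (simp add: tautology_def)
  show ?thesis
    using assms(4)
  proof (induction rule: derives.induct)
    case (assumption B)
    then show ?case
      using A weaken[OF derives.assumption] derives_taut[of "Imp A A" h CS \<Delta>]
      by (auto simp: tautology_def)
  next
    case ("axiom" B)
    then show ?case by (intro weaken derives.axiom)
  next
    case (modus_ponens B C)
    then have "Imp A (Imp B C) \<in> Fm h" using derives_Fm[OF CS \<Delta>] by blast
    with derives_taut_mp2[OF modus_ponens.IH, of "Imp A C"] show ?case
      by (simp add: tautology_def)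
  next
    case (axiom_necessitation s n B)
    then show ?case by (intro weaken derives.axiom_necessitation)
  qed
qed

text \<open>Compactness for chains: at modus ponens the larger of the two members serves both
  premises. Axioms and constants still require some member, hence the nonempty chain.\<close>

lemma derives_Union_chain:
  assumes chain: "subset.chain \<A> \<C>" and ne: "\<C> \<noteq> {}" and "derives h CS (\<Union>\<C>) A"
  shows "\<exists>\<Delta>\<in>\<C>. derives h CS \<Delta> A"
  using assms(3)
proof (induction rule: derives.induct)
  case (assumption A)
  then show ?case by (auto intro: derives.assumption)
next
  case ("axiom" A)
  then show ?case using ne by (auto intro: derives.axiom)
next
  case (modus_ponens A B)
  then obtain \<Delta> \<Delta>' where *: "\<Delta> \<in> \<C>" "\<Delta>' \<in> \<C>" "derives h CS \<Delta> (Imp A B)" "derives h CS \<Delta>' A"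
    by blast
  then have "\<Delta> \<subseteq> \<Delta>' \<or> \<Delta>' \<subseteq> \<Delta>" using chain by (auto simp: subset_chain_def)
  with * show ?case by (meson derives_mono derives.modus_ponens)
next
  case (axiom_necessitation s n A)
  then show ?case using ne by (auto intro: derives.axiom_necessitation)
qed

section \<open>Completeness\<close>

text \<open>Maximality relative to an underivable formula \<open>F\<close> replaces maximal consistency, so that no
  falsum has to be encoded.\<close>

locale maximal_not_deriving =
  fixes h :: nat and CS :: "'p fm set" and F :: "'p fm" and \<Gamma> :: "'p fm set"
  assumes h: "h \<ge> 1" and CS: "CS \<subseteq> Fm h" and F: "F \<in> Fm h"
    and subset_Fm: "\<Gamma> \<subseteq> Fm h" and not_derives: "\<not> derives h CS \<Gamma> F"
    and maximal: "\<And>\<Delta>. \<lbrakk>\<Delta> \<subseteq> Fm h; \<not> derives h CS \<Delta> F; \<Gamma> \<subseteq> \<Delta>\<rbrakk> \<Longrightarrow> \<Delta> = \<Gamma>"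
begin

section \<open>Maximal sets as propositional valuations\<close>

lemma derives_Imp_F: "B \<in> Fm h \<Longrightarrow> B \<notin> \<Gamma> \<Longrightarrow> derives h CS \<Gamma> (Imp B F)"
  using maximal[of "insert B \<Gamma>"] subset_Fm deduction[OF CS subset_Fm] by blast

text \<open>\<open>F\<close> acts as falsum: a derivable \<open>B\<close> outside
  \<open>\<Gamma>\<close> would come with a derivable \<open>Imp B F\<close>, by maximality and the
  deduction theorem, and so \<open>F\<close> would be derivable.\<close>

lemma mem_iff_derives: "B \<in> \<Gamma> \<longleftrightarrow> derives h CS \<Gamma> B"
  using derives_Imp_F derives_Fm[OF CS subset_Fm] derives.modus_ponens[of h CS \<Gamma> B F] not_derives
  by (blast intro: derives.assumption)

lemma mem_taut_mp1: "A \<in> \<Gamma> \<Longrightarrow> Imp A B \<in> Fm h \<Longrightarrow> tautology (Imp A B) \<Longrightarrow> B \<in> \<Gamma>"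
  unfolding mem_iff_derives by (rule derives_taut_mp1)

lemma mem_taut_mp2:
  "A \<in> \<Gamma> \<Longrightarrow> B \<in> \<Gamma> \<Longrightarrow> Imp A (Imp B C) \<in> Fm h \<Longrightarrow> tautology (Imp A (Imp B C)) \<Longrightarrow> C \<in> \<Gamma>"
  unfolding mem_iff_derives by (rule derives_taut_mp2)

lemma F_notin: "F \<notin> \<Gamma>"
  using not_derives mem_iff_derives by blast

lemma Neg_mem_iff:
  assumes B: "B \<in> Fm h"
  shows "Neg B \<in> \<Gamma> \<longleftrightarrow> B \<notin> \<Gamma>"
proof
  show "B \<notin> \<Gamma>" if "Neg B \<in> \<Gamma>"
    using mem_taut_mp2[OF that, of B F] F_notin B F by (auto simp: tautology_def)
  show "Neg B \<in> \<Gamma>" if "B \<notin> \<Gamma>"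
  proof (rule ccontr)
    assume "Neg B \<notin> \<Gamma>"
    \<comment> \<open>Case distinction on \<open>B\<close>: these two implications propositionally
      entail \<open>F\<close>.\<close>
    with that have "Imp B F \<in> \<Gamma>" "Imp (Neg B) F \<in> \<Gamma>"
      using derives_Imp_F B mem_iff_derives by auto
    then have "F \<in> \<Gamma>"
      by (rule mem_taut_mp2) (auto simp: B F tautology_def)
    then show False using F_notin by blast
  qed
qed

lemma And_mem_iff:
  assumes "B \<in> Fm h" "C \<in> Fm h"
  shows "And B C \<in> \<Gamma> \<longleftrightarrow> B \<in> \<Gamma> \<and> C \<in> \<Gamma>"
  using mem_taut_mp1[of "And B C" B] mem_taut_mp1[of "And B C" C] mem_taut_mp2[of B C "And B C"]
    assms by (auto simp: tautology_def)

lemma Or_mem_iff: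
  assumes "B \<in> Fm h" "C \<in> Fm h"
  shows "Or B C \<in> \<Gamma> \<longleftrightarrow> B \<in> \<Gamma> \<or> C \<in> \<Gamma>"
  using mem_taut_mp1[of B "Or B C"] mem_taut_mp1[of C "Or B C"]
    mem_taut_mp2[of "Or B C" "Neg B" C] Neg_mem_iff
    assms by (auto simp: tautology_def)

lemma Imp_mem_iff:
  assumes "B \<in> Fm h" "C \<in> Fm h"
  shows "Imp B C \<in> \<Gamma> \<longleftrightarrow> (B \<in> \<Gamma> \<longrightarrow> C \<in> \<Gamma>)"
  using mem_taut_mp1[of "Neg B" "Imp B C"] mem_taut_mp1[of C "Imp B C"]
    mem_taut_mp2[of "Imp B C" B C] Neg_mem_iff
    assms by (auto simp: tautology_def)

text \<open>This allows propositional reasoning about \<open>\<Gamma>\<close> to be done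
  semantically, in particular for the conjunction in the tupling scheme.\<close>

lemma peval_mem: "B \<in> Fm h \<Longrightarrow> peval (\<lambda>C. C \<in> \<Gamma>) B \<longleftrightarrow> B \<in> \<Gamma>"
  by (induction B) (auto simp: Neg_mem_iff And_mem_iff Or_mem_iff Imp_mem_iff)

lemma axiom_mem: "A \<in> Fm h \<Longrightarrow> axiom_scheme h A \<Longrightarrow> A \<in> \<Gamma>"
  unfolding mem_iff_derives by (rule derives.axiom) (simp add: Axioms_def)

lemma mem_axiom_mp:
  assumes "axiom_scheme h (Imp A B)" "A \<in> \<Gamma>" "B \<in> Fm h"
  shows "B \<in> \<Gamma>"
  using axiom_mem[OF _ assms(1)] assms subset_Fm Imp_mem_iff by auto

section \<open>Factivity and the one-world model\<close>

lemma Just_memD: "Just s t A \<in> \<Gamma> \<Longrightarrow> s \<in> all_sorts h \<and> is_tm h s t \<and> A \<in> Fm h"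
  using subset_Fm Fm_simps(6) by blast

lemma Just_Agent_mem: "Just (Agent i) t A \<in> \<Gamma> \<Longrightarrow> A \<in> \<Gamma>"
  using Just_memD by (blast intro: mem_axiom_mp[OF axiom_scheme.reflection])

lemma Just_Everyone_mem:
  assumes "Just Everyone t A \<in> \<Gamma>"
  shows "A \<in> \<Gamma>"
proof -
  \<comment> \<open>Agent 1 exists because \<open>h \<ge> 1\<close>; its reflection axiom then gives
    \<open>A\<close>.\<close>
  have "Just (Agent 1) (Proj 1 t) A \<in> \<Gamma>"
    using Just_memD[OF assms] h by (intro mem_axiom_mp[OF axiom_scheme.projection assms]) auto
  then show ?thesis by (rule Just_Agent_mem)
qed

lemma Just_Common_mem:
  assumes "Just Common t A \<in> \<Gamma>"
  shows "A \<in> \<Gamma>"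
proof -
  have "Just Everyone (Hd t) A \<in> \<Gamma>"
    using Just_memD[OF assms] by (intro mem_axiom_mp[OF axiom_scheme.co_closure_hd assms]) auto
  then show ?thesis by (rule Just_Everyone_mem)
qed

lemma Just_mem: "Just s t A \<in> \<Gamma> \<Longrightarrow> A \<in> \<Gamma>"
  using Just_Agent_mem Just_Everyone_mem Just_Common_mem by (cases s) blast+

text \<open>The element \<open>undefined\<close> is available in every type \<open>'w\<close>. The
  sort in the evidence is bound existentially because an evidence function receives only the
  term.\<close>

definition model :: "('w, 'p) kripke" where
  "model = \<lparr>worlds = {undefined}, acc = \<lambda>_. {(undefined, undefined)},
     evidence = \<lambda>_ t. {A. \<exists>s. Just s t A \<in> \<Gamma>},
     valuation = \<lambda>P. if Prop P \<in> \<Gamma> then {undefined} else {}\<rparr>"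

lemma model_simps:
  "worlds model = {undefined}"
  "acc model i = {(undefined, undefined)}"
  "valuation model P = (if Prop P \<in> \<Gamma> then {undefined} else {})"
  "evidence model w t = {A. \<exists>s. Just s t A \<in> \<Gamma>}"
  by (simp_all add: model_def)

text \<open>A well-formed term has one sort, so the existential collapses to that sort.\<close>

lemma evidence_model: "is_tm h s t \<Longrightarrow> A \<in> evidence model w t \<longleftrightarrow> Just s t A \<in> \<Gamma>"
  unfolding model_simps using is_tm_unique_sort Just_memD by blast

text \<open>With at least one agent the union over agents is the full relation on one point, and so
  is its transitive closure.\<close>

lemma acc_sort_model: "acc_sort h model s = {(undefined, undefined)}"
proof -
  have E: "acc_E h model = {(undefined, undefined)}"
    using h by (auto simp: acc_E_def model_simps)
  have "acc_C h model \<subseteq> {undefined} \<times> {undefined}"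
    unfolding acc_C_eq_trancl E by (rule trancl_subset_Sigma) simp
  then have "acc_C h model = {(undefined, undefined)}"
    using E acc_E_subset_acc_C by fastforce
  with E show ?thesis by (cases s) (auto simp: model_simps)
qed

text \<open>Truth lemma. For \<open>Just\<close>, the only accessible world is the world itself, so
  the modal half asks for \<open>A \<in> \<Gamma>\<close>, which factivity supplies.\<close>

lemma sat_model: "A \<in> Fm h \<Longrightarrow> sat h model undefined A \<longleftrightarrow> A \<in> \<Gamma>"
proof (induction A)
  case (Just s t A)
  then show ?case using Just_mem[of s t A] by (auto simp: evidence_model acc_sort_model)
qed (auto simp: model_simps Neg_mem_iff And_mem_iff Or_mem_iff Imp_mem_iff)

lemma Tup_mem:
  assumes ts: "length ts = h" and mem: "\<forall>i\<in>{1..h}. Just (Agent i) (ts ! (i - 1)) A \<in> \<Gamma>"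
  shows "Just Everyone (Tup ts) A \<in> \<Gamma>"
proof -
  let ?As = "map (\<lambda>i. Just (Agent i) (ts ! (i - 1)) A) [1..<Suc h]"
  have ne: "?As \<noteq> []" using h by simp
  have sub: "set ?As \<subseteq> \<Gamma>"
  proof
    fix B assume "B \<in> set ?As"
    then obtain i where "i \<in> {1..h}" "B = Just (Agent i) (ts ! (i - 1)) A"
      by (auto simp only: set_map set_upt atLeastLessThanSuc_atLeastAtMost)
    then show "B \<in> \<Gamma>" using mem by blast
  qed
  then have "\<forall>B\<in>set ?As. peval (\<lambda>C. C \<in> \<Gamma>) B"
    using subset_Fm peval_mem by blast
  then have "conj_list ?As \<in> \<Gamma>"
    using peval_conj_list[OF ne] peval_mem conj_list_Fm[OF ne] sub subset_Fm by blast
  moreover have "Just Everyone (Tup ts) A \<in> Fm h"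
  proof -
    have "\<forall>i\<in>{1..h}. is_tm h (Agent i) (ts ! (i - 1)) \<and> A \<in> Fm h"
      using mem Just_memD by blast
    with ts h show ?thesis by auto
  qed
  ultimately show ?thesis by (rule mem_axiom_mp[OF axiom_scheme.tupling])
qed

text \<open>Evidence is the same at all worlds, so monotonicity is immediate. The constant condition
  is axiom necessitation, and the other closure conditions mirror axiom schemes.\<close>

lemma af_model_model:
  assumes "constant_specification h CS"
  shows "af_model h CS model"
proof
  show "evidence model w t \<subseteq> Fm h" for w t
    unfolding model_simps using Just_memD by blast
  show "evidence model w t \<subseteq> evidence model v t" for w v t
    by (simp add: model_simps)
  show "A \<in> evidence model w (Const s n)" if "Just s (Const s n) A \<in> CS" for w s n A
    using derives.axiom_necessitation[OF that, of h \<Gamma>]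
    unfolding mem_iff_derives[symmetric] by (auto simp: model_simps)
next
  fix w s t u A B
  assume *: "s \<in> star_sorts h" "is_tm h s t" "is_tm h s u"
    and "Imp A B \<in> evidence model w t" "A \<in> evidence model w u"
  then have mem: "Just s t (Imp A B) \<in> \<Gamma>" "Just s u A \<in> \<Gamma>"
    by (auto simp: evidence_model)
  have "Imp (Just s u A) (Just s (Times s t u) B) \<in> \<Gamma>"
    using Just_memD[OF mem(1)] * by (intro mem_axiom_mp[OF axiom_scheme.app mem(1)]) auto
  then have "Just s (Times s t u) B \<in> \<Gamma>"
    using mem(2) Imp_mem_iff subset_Fm Fm_simps(5) by blast
  then show "B \<in> evidence model w (Times s t u)"
    using * by (simp add: evidence_model[of s])
next
  fix w s t u
  assume *: "s \<in> star_sorts h" "is_tm h s t" "is_tm h s u"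
  have "Just s (Plus s t u) A \<in> \<Gamma>" if "Just s t A \<in> \<Gamma>" for A
    using Just_memD[OF that] * by (intro mem_axiom_mp[OF axiom_scheme.sum_left that]) auto
  moreover have "Just s (Plus s t u) A \<in> \<Gamma>" if "Just s u A \<in> \<Gamma>" for A
    using Just_memD[OF that] * by (intro mem_axiom_mp[OF axiom_scheme.sum_right that]) auto
  ultimately show "evidence model w t \<union> evidence model w u \<subseteq> evidence model w (Plus s t u)"
    using * by (auto simp: evidence_model[of s])
next
  fix w i t A
  assume *: "i \<in> {1..h}" "is_tm h (Agent i) t" and "A \<in> evidence model w t"
  then have mem: "Just (Agent i) t A \<in> \<Gamma>" by (simp add: evidence_model)
  have "Just (Agent i) (Bang i t) (Just (Agent i) t A) \<in> \<Gamma>"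
    using Just_memD[OF mem] by (intro mem_axiom_mp[OF axiom_scheme.inspection mem]) auto
  then show "Just (Agent i) t A \<in> evidence model w (Bang i t)"
    using * by (simp add: evidence_model[of "Agent i"])
next
  fix w ts A
  assume *: "length ts = h" "\<forall>i\<in>{1..h}. is_tm h (Agent i) (ts ! (i - 1))"
    and ev: "\<forall>i\<in>{1..h}. A \<in> evidence model w (ts ! (i - 1))"
  have "Just (Agent i) (ts ! (i - 1)) A \<in> \<Gamma>" if "i \<in> {1..h}" for i
  proof -
    have "is_tm h (Agent i) (ts ! (i - 1))" using *(2) that by (rule bspec)
    moreover have "A \<in> evidence model w (ts ! (i - 1))" using ev that by (rule bspec)
    ultimately show ?thesis by (simp only: evidence_model)
  qed
  then have "Just Everyone (Tup ts) A \<in> \<Gamma>"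
    by (intro Tup_mem *(1) ballI)
  then show "A \<in> evidence model w (Tup ts)"
    using * by (simp add: evidence_model[of Everyone])
next
  fix w i t A
  assume *: "i \<in> {1..h}" "is_tm h Everyone t" and "A \<in> evidence model w t"
  then have mem: "Just Everyone t A \<in> \<Gamma>" by (simp add: evidence_model)
  have "Just (Agent i) (Proj i t) A \<in> \<Gamma>"
    using Just_memD[OF mem] * by (intro mem_axiom_mp[OF axiom_scheme.projection mem]) auto
  then show "A \<in> evidence model w (Proj i t)"
    using * by (simp add: evidence_model[of "Agent i"])
next
  fix w t A
  assume *: "is_tm h Common t" and "A \<in> evidence model w t"
  then have mem: "Just Common t A \<in> \<Gamma>" by (simp add: evidence_model)
  have "Just Everyone (Hd t) A \<in> \<Gamma>"
    using Just_memD[OF mem] by (intro mem_axiom_mp[OF axiom_scheme.co_closure_hd mem]) auto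
  moreover have "Just Everyone (Tl t) (Just Common t A) \<in> \<Gamma>"
    using Just_memD[OF mem] by (intro mem_axiom_mp[OF axiom_scheme.co_closure_tl mem]) auto
  ultimately show "A \<in> evidence model w (Hd t) \<and> Just Common t A \<in> evidence model w (Tl t)"
    using * by (simp add: evidence_model[of Everyone])
next
  fix w t u A
  assume *: "is_tm h Common t" "is_tm h Everyone u"
    and "A \<in> evidence model w u" "Imp A (Just Everyone u A) \<in> evidence model w t"
  then have mem: "Just Everyone u A \<in> \<Gamma>" "Just Common t (Imp A (Just Everyone u A)) \<in> \<Gamma>"
    by (auto simp: evidence_model)
  \<comment> \<open>The evidence condition does not assume the truth of \<open>A\<close> that the
    induction axiom asks for; factivity of the evidence \<open>u\<close> provides it.\<close>
  have A: "A \<in> \<Gamma>" "A \<in> Fm h" using Just_mem Just_memD mem(1) by blast+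
  then have "And A (Just Common t (Imp A (Just Everyone u A))) \<in> \<Gamma>"
    using And_mem_iff mem(2) subset_Fm by blast
  then have "Just Common (Ind t u) A \<in> \<Gamma>"
    by (rule mem_axiom_mp[OF axiom_scheme.induction]) (use A * in auto)
  then show "A \<in> evidence model w (Ind t u)"
    using * by (simp add: evidence_model[of Common])
qed (auto simp: model_simps refl_on_def trans_def)

end

text \<open>Lindenbaum's lemma by Zorn: the union of a chain of sets not deriving \<open>F\<close>
  does not derive \<open>F\<close> either.\<close>

lemma exists_maximal_not_deriving:
  assumes "h \<ge> 1" "CS \<subseteq> Fm h" "F \<in> Fm h" "\<not> derives h CS {} F"
  shows "\<exists>\<Gamma>. maximal_not_deriving h CS F \<Gamma>"
proof -
  let ?\<A> = "{\<Delta>. \<Delta> \<subseteq> Fm h \<and> \<not> derives h CS \<Delta> F}"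
  have "\<exists>\<Gamma>\<in>?\<A>. \<forall>\<Delta>\<in>?\<A>. \<Gamma> \<subseteq> \<Delta> \<longrightarrow> \<Delta> = \<Gamma>"
  proof (rule subset_Zorn_nonempty)
    show "?\<A> \<noteq> {}" using assms(4) by blast
    fix \<C> assume ne: "\<C> \<noteq> {}" and chain: "subset.chain ?\<A> \<C>"
    from chain have sub: "\<C> \<subseteq> ?\<A>" by (simp add: subset_chain_def)
    have "\<not> derives h CS (\<Union>\<C>) F"
    proof
      assume "derives h CS (\<Union>\<C>) F"
      then obtain \<Delta> where "\<Delta> \<in> \<C>" "derives h CS \<Delta> F"
        by (rule bexE[OF derives_Union_chain[OF chain ne]])
      then show False using sub by auto
    qed
    moreover have "\<Union>\<C> \<subseteq> Fm h" using sub by auto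
    ultimately show "\<Union>\<C> \<in> ?\<A>" by simp
  qed
  then obtain \<Gamma> where "\<Gamma> \<in> ?\<A>" "\<forall>\<Delta>\<in>?\<A>. \<Gamma> \<subseteq> \<Delta> \<longrightarrow> \<Delta> = \<Gamma>"
    by blast
  then have "maximal_not_deriving h CS F \<Gamma>"
    using assms(1-3) by unfold_locales blast+
  then show ?thesis ..
qed

theorem theorem1:
  fixes h :: nat and CS :: "'p::countable fm set" and A :: "'p fm"
  assumes "h \<ge> 1"
    and "constant_specification h CS"
    and "A \<in> Fm h"
  shows "derives h CS {} A \<longleftrightarrow> valid TYPE('w) h CS A"
proof
  show "valid TYPE('w) h CS A" if "derives h CS {} A"
    by (simp add: valid_def af_model.sat_derives[OF _ assms(1,2) that])
  show "derives h CS {} A" if valid: "valid TYPE('w) h CS A"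
  proof (rule ccontr)
    assume "\<not> derives h CS {} A"
    then obtain \<Gamma> where "maximal_not_deriving h CS A \<Gamma>"
      using exists_maximal_not_deriving assms constant_specification_subset_Fm by blast
    then interpret maximal_not_deriving h CS A \<Gamma> .
    \<comment> \<open>Validity makes \<open>A\<close> true at the single world, so
      \<open>A \<in> \<Gamma>\<close> by the truth lemma, although \<open>\<Gamma>\<close> was
      chosen not to derive \<open>A\<close>.\<close>
    have "sat h (model :: ('w, 'p) kripke) undefined A"
      by (rule valid[unfolded valid_def, rule_format, OF af_model_model[OF assms(2)]])
        (simp add: model_simps)
    then show False using sat_model F_notin assms(3) by blast
  qed
qed

end
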